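(* Let $a_1,a_2,b_1,b_2,\alpha,\beta,\lambda\in\mathbb{C}$ with $\lambda\neq 0$ and $\varepsilon_0:=a_1b_2-a_2b_1\neq 0$. For $x=(x^1,x^2,x^3,x^4)\in\mathbb{R}^4$ put $$L=\tfrac{1}{\sqrt2}\big[(\lambda\alpha+\beta)x^1+(\lambda\beta-\alpha)x^2+(\lambda\alpha-\beta)x^3+(\lambda\beta+\alpha)x^4\big],$$ $$\psi=\begin{pmatrix} a_1e^{L}+a_2e^{-L} & \overline{b}_1e^{\overline L}+\overline b_2e^{-\overline L}\\ -b_1e^{L}-b_2e^{-L} & \overline a_1e^{\overline L}+\overline a_2e^{-\overline L}\end{pmatrix},\quad \Lambda=\begin{pmatrix}\lambda&0\\0&\overline\lambda\end{pmatrix},\quad J=-\psi\Lambda\psi^{-1},$$ and $$A_1=A_3=-\tfrac12\big[(\partial_1J)J^{-1}+(\partial_3J)J^{-1}\big],\qquad A_2=A_4=-\tfrac12\big[(\partial_2J)J^{-1}+(\partial_4J)J^{-1}\big].$$ Then $JJ^\dagger=|\lambda|^2I$; the gauge fields $A_\mu$ satisfy the anti-self-dual Yang-Mills equations for the split metric; each $A_\mu$ is anti-Hermitian and traceless (so the gauge group can be $\mathrm{SU}(2)$); and the Lagrangian density is real-valued, well defined on the whole of $\mathbb{R}^4$, and equal to $$\mathrm{Tr}\,F_{\mu\nu}F^{\mu\nu}=8\big[(\alpha\overline\beta-\overline\alpha\beta)(\lambda-\overline\lambda)|\varepsilon_0|\big]^2\;\frac{2\varepsilon_1\widetilde\varepsilon_1\sinh^2X_1-2|\varepsilon_2|^2\sinh^2X_2-|\varepsilon_0|^2}{\big[(\varepsilon_1\widetilde\varepsilon_1)^{1/2}\cosh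 X_1+|\varepsilon_2|\cosh X_2\big]^4},$$ where $\varepsilon_1=|a_1|^2+|b_1|^2$, $\widetilde\varepsilon_1=|a_2|^2+|b_2|^2$, $\varepsilon_2=a_1\overline a_2+b_1\overline b_2$ (so that $\varepsilon_1\widetilde\varepsilon_1=|\varepsilon_2|^2+|\varepsilon_0|^2$), $X_1=\overline L+L+\frac12\log(\varepsilon_1/\widetilde\varepsilon_1)$ and $X_2=\overline L-L+\frac12\log(\varepsilon_2/\overline\varepsilon_2)$. If $\varepsilon_2=0$, the part containing $X_2$ is removed and $$\mathrm{Tr}\,F_{\mu\nu}F^{\mu\nu}=8\big[(\alpha\overline\beta-\overline\alpha\beta)(\lambda-\overline\lambda)\big]^2\,(2\,\mathrm{sech}^2X-3\,\mathrm{sech}^4X),\qquad X=L+\overline L+\tfrac12\log\frac{|a_1|^2+|b_1|^2}{|a_2|^2+|b_2|^2}.$$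
   Context: $\partial_\mu=\partial/\partial x^\mu$; $\dagger$ is conjugate transpose. $\mathbb{R}^4$ carries the split metric $ds^2=(dx^1)^2+(dx^2)^2-(dx^3)^2-(dx^4)^2$, used to raise indices; repeated indices are summed. The field strength is $F_{\mu\nu}=\partial_\mu A_\nu-\partial_\nu A_\mu+[A_\mu,A_\nu]$. With real coordinates $z=(x^1+x^3)/\sqrt2$, $\widetilde z=(x^1-x^3)/\sqrt2$, $w=(x^2+x^4)/\sqrt2$, $\widetilde w=-(x^2-x^4)/\sqrt2$ (so $ds^2=2(dz\,d\widetilde z-dw\,d\widetilde w)$), the anti-self-dual Yang-Mills equations are $F_{zw}=0$, $F_{\widetilde z\widetilde w}=0$, $F_{z\widetilde z}-F_{w\widetilde w}=0$, where the components are those of $F$ in the coordinates $(z,\widetilde z,w,\widetilde w)$. In these coordinates $L=\lambda\alpha z+\beta\widetilde z+\lambda\beta w+\alpha\widetilde w$, and the gauge fields above are $A_z=-(\partial_zJ)J^{-1}$, $A_w=-(\partial_wJ)J^{-1}$, $A_{\widetilde z}=A_{\widetilde w}=0$.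
   Formalization: The sign in X_2 is corrected to X_2 = L − conj(L) + ½log(ε_2/conj ε_2), since the printed conj(L) − L makes the Lagrangian formula false; log(ε_2/conj ε_2) is read as 2i·arg ε_2. *)

theory Defs
  imports "HOL-Analysis.Analysis"
begin

text \<open>
  Points of \<open>\<real>\<^sup>4\<close> have type \<open>real^4\<close>. The index type \<open>4\<close> consists of \<open>1, 2, 3, 4\<close>, where
  \<open>4 = 0\<close>. A gauge field \<open>A\<close> is given by its components \<open>A \<mu> x\<close>.
\<close>

definition pd :: "4 \<Rightarrow> (real^4 \<Rightarrow> 'b::real_normed_vector) \<Rightarrow> real^4 \<Rightarrow> 'b" where
  "pd \<mu> f x = frechet_derivative f (at x) (axis \<mu> 1)"

definition ctranspose :: "complex^'n^'m \<Rightarrow> complex^'m^'n" where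
  "ctranspose M = (\<chi> i j. cnj (M $ j $ i))"

definition field_strength ::
    "(4 \<Rightarrow> real^4 \<Rightarrow> complex^2^2) \<Rightarrow> 4 \<Rightarrow> 4 \<Rightarrow> real^4 \<Rightarrow> complex^2^2" where
  "field_strength A \<mu> \<nu> x =
     pd \<mu> (A \<nu>) x - pd \<nu> (A \<mu>) x + (A \<mu> x ** A \<nu> x - A \<nu> x ** A \<mu> x)"

definition split_metric :: "real^4^4" where
  "split_metric = (\<chi> \<mu> \<nu>. if \<mu> = \<nu> then (if \<mu> = 1 \<or> \<mu> = 2 then 1 else -1) else 0)"

definition raised_field_strength ::
    "(4 \<Rightarrow> real^4 \<Rightarrow> complex^2^2) \<Rightarrow> 4 \<Rightarrow> 4 \<Rightarrow> real^4 \<Rightarrow> complex^2^2" where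
  "raised_field_strength A \<mu> \<nu> x =
     (\<Sum>\<rho>\<in>UNIV. \<Sum>\<sigma>\<in>UNIV. (matrix_inv split_metric $ \<mu> $ \<rho> * matrix_inv split_metric $ \<nu> $ \<sigma>)
        *\<^sub>R field_strength A \<rho> \<sigma> x)"

definition lagrangian_density :: "(4 \<Rightarrow> real^4 \<Rightarrow> complex^2^2) \<Rightarrow> real^4 \<Rightarrow> complex" where
  "lagrangian_density A x =
     (\<Sum>\<mu>\<in>UNIV. \<Sum>\<nu>\<in>UNIV. trace (field_strength A \<mu> \<nu> x ** raised_field_strength A \<mu> \<nu> x))"

text \<open>
  The coordinates \<open>(z, z~, w, w~)\<close>, in this order: index 1 is \<open>z\<close>, 2 is \<open>z~\<close>, 3 is \<open>w\<close>
  and 4 is \<open>w~\<close>.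
\<close>

definition to_null :: "real^4 \<Rightarrow> real^4" where
  "to_null x = vector [(x$1 + x$3) / sqrt 2, (x$1 - x$3) / sqrt 2,
                       (x$2 + x$4) / sqrt 2, - (x$2 - x$4) / sqrt 2]"

definition from_null :: "real^4 \<Rightarrow> real^4" where
  "from_null y = vector [(y$1 + y$2) / sqrt 2, (y$3 - y$4) / sqrt 2,
                         (y$1 - y$2) / sqrt 2, (y$3 + y$4) / sqrt 2]"

definition null_field_strength ::
    "(4 \<Rightarrow> real^4 \<Rightarrow> complex^2^2) \<Rightarrow> 4 \<Rightarrow> 4 \<Rightarrow> real^4 \<Rightarrow> complex^2^2" where
  "null_field_strength A a b x =
     (\<Sum>\<mu>\<in>UNIV. \<Sum>\<nu>\<in>UNIV.
        (pd a from_null (to_null x) $ \<mu> * pd b from_null (to_null x) $ \<nu>)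
        *\<^sub>R field_strength A \<mu> \<nu> x)"

definition anti_self_dual_YM :: "(4 \<Rightarrow> real^4 \<Rightarrow> complex^2^2) \<Rightarrow> bool" where
  "anti_self_dual_YM A \<longleftrightarrow>
     (\<forall>x. null_field_strength A 1 3 x = 0 \<and>
          null_field_strength A 2 4 x = 0 \<and>
          null_field_strength A 1 2 x - null_field_strength A 3 4 x = 0)"

definition soliton_L :: "complex \<Rightarrow> complex \<Rightarrow> complex \<Rightarrow> real^4 \<Rightarrow> complex" where
  "soliton_L \<alpha> \<beta> l x = 1 / of_real (sqrt 2) *
     ((l * \<alpha> + \<beta>) * of_real (x$1) + (l * \<beta> - \<alpha>) * of_real (x$2) +
      (l * \<alpha> - \<beta>) * of_real (x$3) + (l * \<beta> + \<alpha>) * of_real (x$4))"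

definition soliton_psi ::
    "complex \<Rightarrow> complex \<Rightarrow> complex \<Rightarrow> complex \<Rightarrow> (real^4 \<Rightarrow> complex) \<Rightarrow> real^4 \<Rightarrow> complex^2^2" where
  "soliton_psi a1 a2 b1 b2 L x = vector
     [vector [a1 * exp (L x) + a2 * exp (- L x),
              cnj b1 * exp (cnj (L x)) + cnj b2 * exp (- cnj (L x))],
      vector [- b1 * exp (L x) - b2 * exp (- L x),
              cnj a1 * exp (cnj (L x)) + cnj a2 * exp (- cnj (L x))]]"

definition soliton_J :: "complex \<Rightarrow> (real^4 \<Rightarrow> complex^2^2) \<Rightarrow> real^4 \<Rightarrow> complex^2^2" where
  "soliton_J l \<psi> x = - (\<psi> x ** vector [vector [l, 0], vector [0, cnj l]] ** matrix_inv (\<psi> x))"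

definition soliton_A :: "(real^4 \<Rightarrow> complex^2^2) \<Rightarrow> 4 \<Rightarrow> real^4 \<Rightarrow> complex^2^2" where
  "soliton_A J \<mu> x =
     (if \<mu> = 1 \<or> \<mu> = 3
      then - (1/2) *\<^sub>R (pd 1 J x ** matrix_inv (J x) + pd 3 J x ** matrix_inv (J x))
      else - (1/2) *\<^sub>R (pd 2 J x ** matrix_inv (J x) + pd 4 J x ** matrix_inv (J x)))"

text \<open>
  \<open>log_phase e\<close> is the value \<open>2 \<i> arg e\<close> of \<open>log (e / cnj e)\<close>. The principal value of that
  logarithm will not do: when \<open>Re e < 0\<close> half of it exponentiates to \<open>- e / \<bar>e\<bar>\<close> instead of
  \<open>e / \<bar>e\<bar>\<close>, which flips the sign of \<open>cosh X\<^sub>2\<close>.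
\<close>

definition log_phase :: "complex \<Rightarrow> complex" where
  "log_phase e = Ln e - cnj (Ln e)"

lemma exp_log_phase: "e \<noteq> 0 \<Longrightarrow> exp (log_phase e) = e / cnj e"
  by (simp add: log_phase_def exp_diff flip: exp_cnj)

lemma exp_half_log_phase:
  assumes "e \<noteq> 0"
  shows "exp (log_phase e / 2) = e / of_real (cmod e)"
proof -
  have "Ln e - cnj (Ln e) = 2 * (Ln e - of_real (Re (Ln e)))"
    by (simp add: complex_eq_iff)
  then have "log_phase e / 2 = Ln e - of_real (ln (cmod e))"
    using assms by (simp add: log_phase_def)
  then have "exp (log_phase e / 2) = exp (Ln e) / exp (of_real (ln (cmod e)))"
    by (simp only: exp_diff)
  also have "\<dots> = e / of_real (cmod e)"
    using assms by (simp add: exp_of_real)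
  finally show ?thesis .
qed

text \<open>
  The sign of \<open>L - cnj L\<close> in \<open>X\<^sub>2\<close> is tied to the choice
  \<open>\<epsilon>\<^sub>2 = a\<^sub>1 cnj a\<^sub>2 + b\<^sub>1 cnj b\<^sub>2\<close>: it is the one for which the denominator of the
  Lagrangian density comes from \<open>det \<psi>\<close>.
\<close>

lemma det_soliton_psi:
  fixes a1 a2 b1 b2 :: complex and L :: "real^4 \<Rightarrow> complex"
  defines "\<epsilon>1 \<equiv> (cmod a1)\<^sup>2 + (cmod b1)\<^sup>2"
    and "\<epsilon>1' \<equiv> (cmod a2)\<^sup>2 + (cmod b2)\<^sup>2"
    and "\<epsilon>2 \<equiv> a1 * cnj a2 + b1 * cnj b2"
  assumes "a1 * b2 - a2 * b1 \<noteq> 0" and "\<epsilon>2 \<noteq> 0"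
  shows "det (soliton_psi a1 a2 b1 b2 L x) =
    2 * (of_real (sqrt (\<epsilon>1 * \<epsilon>1')) * cosh (L x + cnj (L x) + of_real (1/2 * ln (\<epsilon>1 / \<epsilon>1')))
         + of_real (cmod \<epsilon>2) * cosh (L x - cnj (L x) + 1/2 * log_phase \<epsilon>2))"
proof -
  define u v where "u = exp (L x)" and "v = exp (cnj (L x))"
  have uv: "u \<noteq> 0" "v \<noteq> 0" by (auto simp: u_def v_def)
  have pos: "\<epsilon>1 > 0" "\<epsilon>1' > 0"
    using assms(4) by (auto simp: \<epsilon>1_def \<epsilon>1'_def sum_power2_gt_zero_iff)
  define s where "s = exp (1/2 * ln (\<epsilon>1 / \<epsilon>1'))"
  have s: "s = sqrt \<epsilon>1 / sqrt \<epsilon>1'"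
    using pos by (simp add: s_def ln_div exp_diff diff_divide_distrib flip: ln_sqrt)
  have s1: "sqrt (\<epsilon>1 * \<epsilon>1') * s = \<epsilon>1" and s2: "sqrt (\<epsilon>1 * \<epsilon>1') / s = \<epsilon>1'"
    using pos by (auto simp: s real_sqrt_mult)
  define S where "S = complex_of_real (sqrt (\<epsilon>1 * \<epsilon>1'))"
  define p where "p = exp (1/2 * log_phase \<epsilon>2)"
  have p: "p = \<epsilon>2 / of_real (cmod \<epsilon>2)"
    using exp_half_log_phase[OF assms(5)] by (simp add: p_def)
  have p0: "p \<noteq> 0" by (simp add: p_def)
  have ee: "\<epsilon>2 * cnj \<epsilon>2 = of_real (cmod \<epsilon>2) * of_real (cmod \<epsilon>2)"
    by (simp add: complex_norm_square[symmetric] power2_eq_square[symmetric])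
  have p1: "of_real (cmod \<epsilon>2) * p = \<epsilon>2" and p2: "of_real (cmod \<epsilon>2) / p = cnj \<epsilon>2"
    using assms(5) ee by (auto simp: p field_simps)
  have S1: "S * of_real s = of_real \<epsilon>1" and S2: "S / of_real s = of_real \<epsilon>1'"
    unfolding S_def by (metis of_real_mult s1, metis of_real_divide s2)
  have c1: "2 * (S * cosh (L x + cnj (L x) + of_real (1/2 * ln (\<epsilon>1 / \<epsilon>1')))) =
      u * v * (S * of_real s) + (S / of_real s) / (u * v)"
  proof -
    have "exp (complex_of_real (1/2 * ln (\<epsilon>1 / \<epsilon>1'))) = of_real s"
      unfolding s_def by (rule exp_of_real)
    moreover have "s \<noteq> 0" by (simp add: s_def)
    ultimately show ?thesis
      unfolding cosh_field_def exp_add exp_minus u_def[symmetric] v_def[symmetric]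
      using uv by (simp add: field_simps)
  qed
  have c2: "2 * (of_real (cmod \<epsilon>2) * cosh (L x - cnj (L x) + 1/2 * log_phase \<epsilon>2)) =
      u / v * (of_real (cmod \<epsilon>2) * p) + v / u * (of_real (cmod \<epsilon>2) / p)"
    unfolding cosh_field_def exp_add exp_minus exp_diff u_def[symmetric] v_def[symmetric]
      p_def[symmetric]
    using uv p0 by (simp add: field_simps)
  have "det (soliton_psi a1 a2 b1 b2 L x) =
      (a1 * u + a2 / u) * (cnj a1 * v + cnj a2 / v) + (b1 * u + b2 / u) * (cnj b1 * v + cnj b2 / v)"
    by (simp add: det_2 soliton_psi_def u_def v_def exp_minus divide_inverse algebra_simps)
  also have "\<dots> = u * v * of_real \<epsilon>1 + of_real \<epsilon>1' / (u * v) + (u / v * \<epsilon>2 + v / u * cnj \<epsilon>2)"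
    using uv
    by (simp add: \<epsilon>1_def \<epsilon>1'_def \<epsilon>2_def complex_norm_square field_simps del: of_real_power)
  finally show ?thesis
    unfolding distrib_left S_def[symmetric] c1 c2 S1 S2 p1 p2 .
qed

lemma vector_4_nth [simp]:
  "(vector [a, b, c, d] :: 'a::zero^4) $ 1 = a"
  "(vector [a, b, c, d] :: 'a::zero^4) $ 2 = b"
  "(vector [a, b, c, d] :: 'a::zero^4) $ 3 = c"
  "(vector [a, b, c, d] :: 'a::zero^4) $ 4 = d"
  unfolding vector_def by simp_all

lemma from_null_to_null: "from_null (to_null x) = x"
  by (simp add: vec_eq_iff forall_4 from_null_def to_null_def field_simps)

lemma to_null_from_null: "to_null (from_null y) = y"
  by (simp add: vec_eq_iff forall_4 from_null_def to_null_def field_simps)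

lemma matrix_inv_split_metric: "matrix_inv split_metric = split_metric"
proof -
  have "split_metric ** split_metric = mat 1"
    by (simp add: vec_eq_iff forall_4 matrix_matrix_mult_def split_metric_def mat_def sum_4)
  then show ?thesis
    unfolding matrix_inv_def
    by (intro some_equality) (auto, metis matrix_mul_assoc matrix_mul_lid matrix_mul_rid)
qed

lemma split_metric_null:
  "x \<bullet> (split_metric *v x) =
     2 * (to_null x $ 1 * to_null x $ 2 - to_null x $ 3 * to_null x $ 4)"
  by (simp add: inner_vec_def matrix_vector_mult_def split_metric_def to_null_def sum_4
      field_simps)

end

(*
With p = a1 e^L + a2 e^-L and r = b1 e^L + b2 e^-L, the matrix J equals
-(cnj l I + (l - cnj l) P), where P is the orthogonal projection onto the first column (p, -r)
of psi. Since the Wronskian r p' - p r' is the constant 2 e0, the derivative of P is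
2 (dL M + cnj(dL) M^H), where ^H is the adjoint and M is nilpotent of rank one, so that the
gauge field is A_mu = c (k_mu M + cnj(k_mu) M^H) with constants k_mu. Writing
dM = dL M' + cnj(dL) K, one finds that M' is a multiple of M and K = 2 [M, M^H]. Hence every component of the field strength is a constant
combination of M', K and M'^H; the anti-self-dual equations are linear relations between those
constants, and the Lagrangian density reduces to the three traces
tr M' M'^H = 4 |E|^2 |e0|^2 / D^4, tr K^2 = 8 |e0|^4 / D^4 and tr M' K = 0. Here D = det psi and
E = dD/dL are 2 (S cosh X1 + R cosh X2) and 2 (S sinh X1 + R sinh X2), with
S = sqrt (eps1 eps1') and R = |eps2|.
*)

theory Submission
  imports Defs
begin

section \<open>2x2 complex matrices and entrywise differentiation\<close>

definition mat2 :: "complex \<Rightarrow> complex \<Rightarrow> complex \<Rightarrow> complex \<Rightarrow> complex^2^2" where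
  "mat2 a b c d = vector [vector [a, b], vector [c, d]]"

text \<open>The factors below are complex, whereas \<open>*\<^sub>R\<close> scales by reals
  only.\<close>

definition mscale :: "complex \<Rightarrow> complex^2^2 \<Rightarrow> complex^2^2" where
  "mscale k A = (\<chi> i j. k * A $ i $ j)"

lemma mat2_nth [simp]:
  "mat2 a b c d $ 1 $ 1 = a" "mat2 a b c d $ 1 $ 2 = b"
  "mat2 a b c d $ 2 $ 1 = c" "mat2 a b c d $ 2 $ 2 = d"
  by (simp_all add: mat2_def)

lemma mat2_eqI:
  fixes A B :: "complex^2^2"
  assumes "A $ 1 $ 1 = B $ 1 $ 1" "A $ 1 $ 2 = B $ 1 $ 2" "A $ 2 $ 1 = B $ 2 $ 1" "A $ 2 $ 2 = B $ 2 $ 2"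
  shows "A = B"
  using assms by (simp add: vec_eq_iff forall_2)

lemma mscale_nth [simp]: "mscale k A $ i $ j = k * A $ i $ j"
  by (simp add: mscale_def)

lemma ctranspose_nth [simp]: "ctranspose A $ i $ j = cnj (A $ j $ i)"
  by (simp add: ctranspose_def)

lemma matrix_mult_nth_2 [simp]:
  fixes A B :: "complex^2^2"
  shows "(A ** B) $ i $ j = A $ i $ 1 * B $ 1 $ j + A $ i $ 2 * B $ 2 $ j"
  by (simp add: matrix_matrix_mult_def sum_2)

lemma has_derivative_vecI:
  fixes f :: "'a::real_normed_vector \<Rightarrow> 'b::euclidean_space^'n"
  assumes "\<And>i. ((\<lambda>x. f x $ i) has_derivative (\<lambda>h. f' h $ i)) (at x within S)"
  shows "(f has_derivative f') (at x within S)"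
  unfolding has_derivative_componentwise_within[of f]
proof
  fix b :: "'b^'n" assume "b \<in> Basis"
  then obtain i u where b: "b = axis i u" "u \<in> Basis"
    by (auto simp: Basis_vec_def)
  have "((\<lambda>x. f x $ i \<bullet> u) has_derivative (\<lambda>h. f' h $ i \<bullet> u)) (at x within S)"
    by (intro has_derivative_inner_left assms)
  then show "((\<lambda>x. f x \<bullet> b) has_derivative (\<lambda>h. f' h \<bullet> b)) (at x within S)"
    by (simp add: b inner_axis)
qed

lemma has_derivative_mat2I:
  fixes f :: "'a::real_normed_vector \<Rightarrow> complex^2^2"
  assumes "((\<lambda>x. f x $ 1 $ 1) has_derivative (\<lambda>h. f' h $ 1 $ 1)) (at x within S)"
    and "((\<lambda>x. f x $ 1 $ 2) has_derivative (\<lambda>h. f' h $ 1 $ 2)) (at x within S)"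
    and "((\<lambda>x. f x $ 2 $ 1) has_derivative (\<lambda>h. f' h $ 2 $ 1)) (at x within S)"
    and "((\<lambda>x. f x $ 2 $ 2) has_derivative (\<lambda>h. f' h $ 2 $ 2)) (at x within S)"
  shows "(f has_derivative f') (at x within S)"
proof (intro has_derivative_vecI)
  show "((\<lambda>x. f x $ i $ j) has_derivative (\<lambda>h. f' h $ i $ j)) (at x within S)" for i j
    using exhaust_2[of i] exhaust_2[of j] assms by auto
qed

lemma has_derivative_exp_complex:
  fixes g :: "'a::real_normed_vector \<Rightarrow> complex"
  assumes "(g has_derivative g') (at x within S)"
  shows "((\<lambda>x. exp (g x)) has_derivative (\<lambda>h. exp (g x) * g' h)) (at x within S)"
  using has_derivative_compose[OF assms, of exp "(*) (exp (g x))"] DERIV_exp[of "g x"]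
  by (simp add: has_field_derivative_def)

lemma pd_eq: "(f has_derivative f') (at x) \<Longrightarrow> pd \<mu> f x = f' (axis \<mu> 1)"
  by (simp add: pd_def frechet_derivative_at[symmetric])

lemma matrix_inv_eqI:
  fixes A B :: "'a::field^'n^'n"
  assumes "A ** B = mat 1"
  shows "matrix_inv A = B"
proof -
  have BA: "B ** A = mat 1"
    using assms by (simp add: matrix_left_right_inverse)
  have "A ** matrix_inv A = mat 1 \<and> matrix_inv A ** A = mat 1"
    unfolding matrix_inv_def by (rule someI[of _ B]) (simp add: assms BA)
  then show ?thesis
    by (metis BA matrix_mul_assoc matrix_mul_lid matrix_mul_rid)
qed

lemma scaleR_eq_mscale: "c *\<^sub>R A = mscale (of_real c) A"
  by (rule mat2_eqI; simp only: vector_scaleR_component mscale_nth; simp only: scaleR_conv_of_real)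

lemma mscale_linear: "bounded_linear (mscale k)"
proof (rule linear_conv_bounded_linear[THEN iffD1], rule linearI)
  show "mscale k (A + B) = mscale k A + mscale k B" for A B
    by (rule mat2_eqI) (simp_all add: algebra_simps)
  show "mscale k (c *\<^sub>R A) = c *\<^sub>R mscale k A" for c A
    by (rule mat2_eqI) simp_all
qed

lemmas has_derivative_mscale [derivative_intros] =
  bounded_linear.has_derivative[OF mscale_linear]

lemma ctranspose_linear: "bounded_linear (ctranspose :: complex^2^2 \<Rightarrow> _)"
proof (rule linear_conv_bounded_linear[THEN iffD1], rule linearI)
  show "ctranspose (A + B) = ctranspose A + ctranspose B" for A B :: "complex^2^2"
    by (rule mat2_eqI) simp_all
  show "ctranspose (c *\<^sub>R A) = c *\<^sub>R ctranspose A" for c and A :: "complex^2^2"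
    by (rule mat2_eqI) simp_all
qed

lemmas has_derivative_ctranspose [derivative_intros] =
  bounded_linear.has_derivative[OF ctranspose_linear]

section \<open>Null coordinates and raising of indices\<close>

lemma from_null_linear: "bounded_linear from_null"
proof (rule linear_conv_bounded_linear[THEN iffD1], rule linearI)
  show "from_null (x + y) = from_null x + from_null y" for x y
    by (simp add: from_null_def vec_eq_iff forall_4 add_divide_distrib diff_divide_distrib)
  show "from_null (c *\<^sub>R x) = c *\<^sub>R from_null x" for c x
    by (simp add: from_null_def vec_eq_iff forall_4 algebra_simps)
qed

lemma pd_from_null: "pd a from_null y = from_null (axis a 1)"
  by (rule pd_eq[OF bounded_linear_imp_has_derivative[OF from_null_linear]])

text \<open>\<open>from_null\<close> is linear, so its partial derivatives are constant with entries
  0 or +-1/sqrt 2; two such factors give the 1/2.\<close>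

lemma null_field_strength_eq:
  "null_field_strength A 1 3 x = (1/2) *\<^sub>R
     (field_strength A 1 2 x + field_strength A 1 4 x + field_strength A 3 2 x + field_strength A 3 4 x)"
  "null_field_strength A 2 4 x = (1/2) *\<^sub>R
     (field_strength A 1 4 x - field_strength A 1 2 x + field_strength A 3 2 x - field_strength A 3 4 x)"
  "null_field_strength A 1 2 x = (1/2) *\<^sub>R
     (field_strength A 1 1 x - field_strength A 1 3 x + field_strength A 3 1 x - field_strength A 3 3 x)"
  "null_field_strength A 3 4 x = (1/2) *\<^sub>R
     (field_strength A 2 4 x - field_strength A 2 2 x - field_strength A 4 2 x + field_strength A 4 4 x)"
  by (simp_all add: null_field_strength_def pd_from_null from_null_def axis_def sum_4 algebra_simps)

lemma raised_field_strength_eq: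
  "raised_field_strength A \<mu> \<nu> x =
     (split_metric $ \<mu> $ \<mu> * split_metric $ \<nu> $ \<nu>) *\<^sub>R field_strength A \<mu> \<nu> x"
  using exhaust_4[of \<mu>] exhaust_4[of \<nu>]
  unfolding raised_field_strength_def matrix_inv_split_metric
  by (auto simp: sum_4 split_metric_def)

text \<open>Named so that \<open>algebra\<close> can treat 1/sqrt 2 as a variable subject only to
  \<open>inv_sqrt2_square\<close>.\<close>

definition inv_sqrt2 :: complex where "inv_sqrt2 = 1 / of_real (sqrt 2)"

lemma cnj_inv_sqrt2 [simp]: "cnj inv_sqrt2 = inv_sqrt2"
  by (simp add: inv_sqrt2_def)

lemma inv_sqrt2_square: "2 * inv_sqrt2 * inv_sqrt2 = 1"
proof -
  have "complex_of_real (sqrt 2) * of_real (sqrt 2) = 2"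
    by (metis abs_numeral of_real_mult of_real_numeral real_sqrt_mult_self)
  then show ?thesis
    by (simp add: inv_sqrt2_def field_simps)
qed

section \<open>The soliton functions, the projection \<open>P\<close> and the shape of
  \<open>J\<close>\<close>

locale soliton =
  fixes a1 a2 b1 b2 \<alpha> \<beta> l :: complex
  assumes l_nonzero: "l \<noteq> 0"
    and wronskian_nonzero: "a1 * b2 - a2 * b1 \<noteq> 0"
begin

definition e0 :: complex where "e0 = a1 * b2 - a2 * b1"
abbreviation L :: "real^4 \<Rightarrow> complex" where "L \<equiv> soliton_L \<alpha> \<beta> l"
abbreviation \<psi> where "\<psi> \<equiv> soliton_psi a1 a2 b1 b2 L"
abbreviation J where "J \<equiv> soliton_J l \<psi>"
abbreviation A where "A \<equiv> soliton_A J"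

definition p where "p x = a1 * exp (L x) + a2 * exp (- L x)"
definition r where "r x = b1 * exp (L x) + b2 * exp (- L x)"
text \<open>The prime on \<open>p\<close> and \<open>r\<close> stands for differentiation with
  respect to \<open>L\<close>.\<close>

definition p' where "p' x = a1 * exp (L x) - a2 * exp (- L x)"
definition r' where "r' x = b1 * exp (L x) - b2 * exp (- L x)"

definition D where "D x = p x * cnj (p x) + r x * cnj (r x)"
definition E where "E x = p' x * cnj (p x) + r' x * cnj (r x)"
text \<open>With the reciprocal as a variable of its own, tied to \<open>p\<close> and
  \<open>r\<close> by \<open>D_I\<close>, the matrix identities below become polynomial.\<close>

definition I where "I x = inverse (D x)"

text \<open>The terms in exp (2L) and exp (-2L) cancel; in the mixed products the exponentials
  multiply to 1.\<close>

lemma wronskian: "r x * p' x - p x * r' x = 2 * e0"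
proof -
  have "exp (L x) * exp (- L x) = 1" by (simp add: exp_minus_inverse)
  then show ?thesis unfolding p_def r_def p'_def r'_def e0_def by algebra
qed

lemma wronskian_cnj: "cnj (r x) * cnj (p' x) - cnj (p x) * cnj (r' x) = 2 * cnj e0"
  using arg_cong[OF wronskian, of cnj x] by simp

lemma D_real: "D x = of_real ((cmod (p x))\<^sup>2 + (cmod (r x))\<^sup>2)"
  unfolding D_def of_real_add complex_norm_square ..

text \<open>\<open>D\<close> is a sum of two squared moduli, and a common zero of \<open>p\<close>
  and \<open>r\<close> would annihilate the Wronskian. This is what makes all fields regular on the
  whole space.\<close>

lemma D_nonzero: "D x \<noteq> 0"
proof
  assume "D x = 0"
  then have "(cmod (p x))\<^sup>2 + (cmod (r x))\<^sup>2 = 0"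
    unfolding D_real of_real_eq_0_iff .
  then have "p x = 0" "r x = 0"
    by (simp_all add: sum_power2_eq_zero_iff)
  then show False
    using wronskian[of x] wronskian_nonzero by (simp add: e0_def)
qed

lemma D_I: "(p x * cnj (p x) + r x * cnj (r x)) * I x = 1"
  using D_nonzero[of x] by (simp add: I_def D_def)

lemma cnj_I [simp]: "cnj (I x) = I x"
  by (simp add: I_def D_def mult.commute)

definition P where
  "P x = mat2 (I x * p x * cnj (p x)) (- I x * p x * cnj (r x))
              (- I x * r x * cnj (p x)) (I x * r x * cnj (r x))"

text \<open>Let v = (p, -r) and w = (cnj r, cnj p) be the columns of \<psi>. They are orthogonal,
  and \<open>M\<close> is e0 I^2 w v^H, so its square is 0.\<close>

definition M where
  "M x = mat2 (e0 * (I x)\<^sup>2 * cnj (r x) * cnj (p x)) (- e0 * (I x)\<^sup>2 * (cnj (r x))\<^sup>2)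
              (e0 * (I x)\<^sup>2 * (cnj (p x))\<^sup>2) (- e0 * (I x)\<^sup>2 * cnj (r x) * cnj (p x))"

definition M' where "M' x = mscale (- 2 * E x * I x) (M x)"

definition K where
  "K x = mscale (2 * e0 * cnj e0 * (I x)\<^sup>2) (mat 1 - mscale 2 (P x))"

lemma psi_eq: "\<psi> x = mat2 (p x) (cnj (r x)) (- r x) (cnj (p x))"
  by (simp add: soliton_psi_def mat2_def p_def r_def exp_cnj)

lemma psi_inverse: "\<psi> x ** mat2 (I x * cnj (p x)) (- I x * cnj (r x)) (I x * r x) (I x * p x) = mat 1"
  using D_I[of x] by (intro mat2_eqI) (simp_all add: psi_eq mat_def algebra_simps)

text \<open>Spectral decomposition: the columns of \<psi> are orthogonal eigenvectors of
  \<open>J\<close> for \<open>- l\<close> and \<open>- cnj l\<close>, and \<open>P\<close> projects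
  onto the first.\<close>

lemma J_eq: "J x = - (mscale (cnj l) (mat 1) + mscale (l - cnj l) (P x))"
  unfolding soliton_J_def matrix_inv_eqI[OF psi_inverse] mat2_def[symmetric]
proof (rule mat2_eqI, goal_cases)
  case 1 show ?case
    using D_I[of x] by (simp add: psi_eq mat_def P_def) algebra
next
  case 2 show ?case
    by (simp add: psi_eq mat_def P_def algebra_simps)
next
  case 3 show ?case
    by (simp add: psi_eq mat_def P_def algebra_simps)
next
  case 4 show ?case
    using D_I[of x] by (simp add: psi_eq mat_def P_def) algebra
qed

section \<open>Derivatives of \<open>P\<close>, \<open>M\<close> and \<open>J\<close>\<close>

lemma L_linear: "bounded_linear L"
proof (rule linear_conv_bounded_linear[THEN iffD1], rule linearI)
  show "L (x + y) = L x + L y" for x y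
    by (simp add: soliton_L_def algebra_simps add_divide_distrib)
  show "L (c *\<^sub>R x) = c *\<^sub>R L x" for x c
    unfolding scaleR_conv_of_real[of c "L x"] by (simp add: soliton_L_def algebra_simps)
qed

lemma L_derivative [derivative_intros]: "(L has_derivative L) (at x)"
  by (rule bounded_linear_imp_has_derivative[OF L_linear])

lemma exp_L_derivative [derivative_intros]:
  "((\<lambda>x. exp (L x)) has_derivative (\<lambda>h. exp (L x) * L h)) (at x)"
  "((\<lambda>x. exp (- L x)) has_derivative (\<lambda>h. - exp (- L x) * L h)) (at x)"
  using has_derivative_exp_complex[OF has_derivative_minus[OF L_derivative], of x]
  by (simp_all add: has_derivative_exp_complex L_derivative)

lemma p_derivative [derivative_intros]: "(p has_derivative (\<lambda>h. p' x * L h)) (at x)"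
  unfolding p_def p'_def by (auto intro!: derivative_eq_intros simp: algebra_simps)

lemma r_derivative [derivative_intros]: "(r has_derivative (\<lambda>h. r' x * L h)) (at x)"
  unfolding r_def r'_def by (auto intro!: derivative_eq_intros simp: algebra_simps)

lemma D_derivative [derivative_intros]:
  "(D has_derivative (\<lambda>h. E x * L h + cnj (E x) * cnj (L h))) (at x)"
  unfolding D_def E_def by (rule derivative_eq_intros refl ext)+ (simp add: algebra_simps)

lemma I_derivative [derivative_intros]:
  "(I has_derivative (\<lambda>h. - (I x)\<^sup>2 * (E x * L h + cnj (E x) * cnj (L h)))) (at x)"
  unfolding I_def
  by (rule derivative_eq_intros refl ext D_nonzero)+
     (simp add: power2_eq_square algebra_simps)

text \<open>Only the part of dv orthogonal to v = (p, -r) moves the projection onto v. Its inner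
  product with w = (cnj r, cnj p) is the Wronskian times dL, which produces the factor 2 e0 in 2
  M.\<close>

lemma P_derivative:
  "(P has_derivative (\<lambda>h. 2 *\<^sub>R (mscale (L h) (M x) + mscale (cnj (L h)) (ctranspose (M x))))) (at x)"
proof -
  \<comment> \<open>Modulo these relations every entry is a polynomial identity in which a quantity
    and its conjugate count as independent variables.\<close>
  note identities = wronskian[of x] wronskian_cnj[of x] D_I[of x]
  show ?thesis
    by (rule has_derivative_mat2I; unfold P_def mat2_nth; (rule derivative_eq_intros refl ext)+;
        simp add: M_def E_def scaleR_conv_of_real; use identities in algebra)
qed

text \<open>The entries of \<open>M\<close> are I^2 times polynomials in \<open>cnj p\<close> and
  \<open>cnj r\<close>. Hence the coefficient of \<open>L h\<close> comes from I^2 alone and is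
  again a multiple of \<open>M\<close>.\<close>

lemma M_derivative:
  "(M has_derivative (\<lambda>h. mscale (L h) (M' x) + mscale (cnj (L h)) (K x))) (at x)"
proof -
  note identities = wronskian[of x] wronskian_cnj[of x] D_I[of x]
  show ?thesis
    by (rule has_derivative_mat2I; unfold M_def mat2_nth; (rule derivative_eq_intros refl ext)+;
        simp add: M'_def M_def K_def P_def mat_def E_def; use identities in algebra)
qed

lemma J_derivative:
  "(J has_derivative (\<lambda>h. mscale (- 2 * (l - cnj l))
      (mscale (L h) (M x) + mscale (cnj (L h)) (ctranspose (M x))))) (at x)"
proof -
  have J: "J = (\<lambda>x. - (mscale (cnj l) (mat 1) + mscale (l - cnj l) (P x)))"
    by (rule ext) (rule J_eq)
  show ?thesis
    unfolding J
    by (rule derivative_eq_intros P_derivative refl ext)+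
       (rule mat2_eqI; simp add: scaleR_conv_of_real algebra_simps)
qed

text \<open>The two eigenspaces of \<open>J\<close> are orthogonal and its eigenvalues
  \<open>- l\<close> and \<open>- cnj l\<close> have the same modulus.\<close>

lemma J_unitary: "J x ** ctranspose (J x) = mat (of_real ((cmod l)\<^sup>2))"
  unfolding J_eq complex_norm_square
  by (rule mat2_eqI; simp add: P_def mat_def; use D_I[of x] in algebra)

lemma J_inverse: "matrix_inv (J x) = mscale (1 / (l * cnj l)) (ctranspose (J x))"
proof (rule matrix_inv_eqI)
  have "J x ** mscale (1 / (l * cnj l)) (ctranspose (J x)) =
        mscale (1 / (l * cnj l)) (J x ** ctranspose (J x))"
    by (rule mat2_eqI) (simp_all add: algebra_simps add_divide_distrib)
  also have "\<dots> = mat 1"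
    unfolding J_unitary complex_norm_square
    using l_nonzero by (intro mat2_eqI) (simp_all add: mat_def)
  finally show "J x ** mscale (1 / (l * cnj l)) (ctranspose (J x)) = mat 1" .
qed

text \<open>Multiplied on the right by the inverse of \<open>J\<close>, the row v^H of
  \<open>M\<close> picks up -1/l and the row w^H of the adjoint picks up -1/cnj l.\<close>

lemma J_log_derivative:
  "pd \<mu> J x ** matrix_inv (J x) =
     mscale (2 * (l - cnj l) / l * L (axis \<mu> 1)) (M x) +
     mscale (2 * (l - cnj l) / cnj l * cnj (L (axis \<mu> 1))) (ctranspose (M x))"
proof -
  define i where "i = 1 / l"
  have i: "l * i = 1" "cnj l * cnj i = 1" "1 / (l * cnj l) = i * cnj i" "1 / cnj l = cnj i"
    using l_nonzero by (simp_all add: i_def)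
  have div: "y / l = y * i" "y / cnj l = y * cnj i" for y
    by (simp_all add: i_def)
  show ?thesis
    unfolding pd_eq[OF J_derivative] J_inverse unfolding J_eq i(3) div
    by (rule mat2_eqI; simp add: P_def M_def mat_def; use i(1,2) D_I[of x] in algebra)
qed

section \<open>The gauge field\<close>

definition k :: "4 \<Rightarrow> complex" where "k \<mu> = (if \<mu> = 1 \<or> \<mu> = 3 then \<alpha> else \<beta>)"

definition c :: complex where "c = - 2 * inv_sqrt2 * (l - cnj l)"

lemma L_axis:
  "L (axis 1 1) = inv_sqrt2 * (l * \<alpha> + \<beta>)"
  "L (axis 2 1) = inv_sqrt2 * (l * \<beta> - \<alpha>)"
  "L (axis 3 1) = inv_sqrt2 * (l * \<alpha> - \<beta>)"
  "L (axis 4 1) = inv_sqrt2 * (l * \<beta> + \<alpha>)"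
  by (simp_all add: soliton_L_def axis_def inv_sqrt2_def)

text \<open>Adding the directions 1 and 3, or 2 and 4, leaves a multiple of l \<alpha> or l \<beta>
  in \<open>L\<close>. The factor \<open>l\<close> cancels the 1/l of the logarithmic derivative,
  and its conjugate does so in the adjoint term, so both terms share the constant
  \<open>c\<close>.\<close>

lemma A_eq: "A \<mu> = (\<lambda>x. mscale (c * k \<mu>) (M x) + mscale (c * cnj (k \<mu>)) (ctranspose (M x)))"
proof
  fix x
  have average: "- (1/2) *\<^sub>R (pd \<mu> J x ** matrix_inv (J x) + pd \<nu> J x ** matrix_inv (J x)) =
      mscale (c * \<kappa>) (M x) + mscale (c * cnj \<kappa>) (ctranspose (M x))"
    if L: "L (axis \<mu> 1) + L (axis \<nu> 1) = 2 * inv_sqrt2 * l * \<kappa>" for \<mu> \<nu> \<kappa>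
  proof -
    have "- (1/2) *\<^sub>R (pd \<mu> J x ** matrix_inv (J x) + pd \<nu> J x ** matrix_inv (J x)) =
        mscale (- (l - cnj l) / l * (L (axis \<mu> 1) + L (axis \<nu> 1))) (M x) +
        mscale (- (l - cnj l) / cnj l * cnj (L (axis \<mu> 1) + L (axis \<nu> 1))) (ctranspose (M x))"
      unfolding J_log_derivative scaleR_eq_mscale
      using l_nonzero by (intro mat2_eqI) (simp_all add: field_simps)
    moreover have "- (l - cnj l) / l * (2 * inv_sqrt2 * l * \<kappa>) = c * \<kappa>"
      and "- (l - cnj l) / cnj l * cnj (2 * inv_sqrt2 * l * \<kappa>) = c * cnj \<kappa>"
      using l_nonzero by (simp_all add: c_def field_simps)
    ultimately show ?thesis
      by (simp only: L)
  qed
  have "L (axis 1 1) + L (axis 3 1) = 2 * inv_sqrt2 * l * \<alpha>"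
       "L (axis 2 1) + L (axis 4 1) = 2 * inv_sqrt2 * l * \<beta>"
    by (simp_all add: L_axis algebra_simps)
  then show "A \<mu> x = mscale (c * k \<mu>) (M x) + mscale (c * cnj (k \<mu>)) (ctranspose (M x))"
    by (cases "\<mu> = 1 \<or> \<mu> = 3"; simp only: soliton_A_def k_def if_True if_False average)
qed

section \<open>Field strength and the anti-self-dual equations\<close>

lemma K_hermitian: "ctranspose (K x) = K x"
  by (rule mat2_eqI) (simp_all add: K_def P_def mat_def)

lemma A_derivative:
  "(A \<mu> has_derivative (\<lambda>h.
      mscale (c * k \<mu> * L h) (M' x) +
      mscale (c * (k \<mu> * cnj (L h) + cnj (k \<mu>) * L h)) (K x) +
      mscale (c * cnj (k \<mu>) * cnj (L h)) (ctranspose (M' x)))) (at x)"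
proof -
  have K: "cnj (K x $ i $ j) = K x $ j $ i" for i j
    using arg_cong[OF K_hermitian, of "\<lambda>m. m $ j $ i" x] by simp
  show ?thesis
    unfolding A_eq
    by (rule derivative_eq_intros M_derivative refl ext)+
       (rule mat2_eqI; simp add: K algebra_simps)
qed

text \<open>As \<open>M\<close> is a multiple of w v^H, the products M M^H and M^H M are one and the
  same multiple of the complementary projections 1 - P and P.\<close>

lemma M_commutator: "M x ** ctranspose (M x) - ctranspose (M x) ** M x = mscale (1/2) (K x)"
proof -
  have "mscale 2 (M x ** ctranspose (M x) - ctranspose (M x) ** M x) = K x"
    by (rule mat2_eqI; simp add: M_def K_def P_def mat_def; use D_I[of x] in algebra)
  then have "mscale (1/2) (mscale 2 (M x ** ctranspose (M x) - ctranspose (M x) ** M x)) = mscale (1/2) (K x)"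
    by simp
  moreover have "mscale (1/2) (mscale 2 B) = B" for B
    by (rule mat2_eqI) simp_all
  ultimately show ?thesis by simp
qed

text \<open>
  The coefficients of \<^term>\<open>M'\<close>, \<^term>\<open>K\<close> and the adjoint of \<^term>\<open>M'\<close> in the field
  strength; they do not depend on the point because \<^term>\<open>L\<close> is linear.
\<close>

definition F_M where "F_M \<mu> \<nu> = c * (k \<nu> * L (axis \<mu> 1) - k \<mu> * L (axis \<nu> 1))"
definition F_M_adj where
  "F_M_adj \<mu> \<nu> = c * (cnj (k \<nu>) * cnj (L (axis \<mu> 1)) - cnj (k \<mu>) * cnj (L (axis \<nu> 1)))"
definition F_K where
  "F_K \<mu> \<nu> = c * (k \<nu> * cnj (L (axis \<mu> 1)) + cnj (k \<nu>) * L (axis \<mu> 1)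
      - k \<mu> * cnj (L (axis \<nu> 1)) - cnj (k \<mu>) * L (axis \<nu> 1)
      + c / 2 * (k \<mu> * cnj (k \<nu>) - cnj (k \<mu>) * k \<nu>))"

lemma field_strength_eq:
  "field_strength A \<mu> \<nu> x =
     mscale (F_M \<mu> \<nu>) (M' x) + mscale (F_K \<mu> \<nu>) (K x) + mscale (F_M_adj \<mu> \<nu>) (ctranspose (M' x))"
proof -
  \<comment> \<open>The products of \<open>M\<close> with itself cancel. The commutator of
    \<open>M\<close> with its adjoint is half of \<open>K\<close>, whence the term with
    \<open>c / 2\<close> in \<open>F_K\<close>.\<close>
  have "A \<mu> x ** A \<nu> x - A \<nu> x ** A \<mu> x =
      mscale (c\<^sup>2 * (k \<mu> * cnj (k \<nu>) - cnj (k \<mu>) * k \<nu>))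
        (M x ** ctranspose (M x) - ctranspose (M x) ** M x)"
    unfolding A_eq by (rule mat2_eqI; simp; algebra)
  then show ?thesis
    unfolding field_strength_def pd_eq[OF A_derivative] M_commutator
    by (intro mat2_eqI)
       (simp_all add: F_M_def F_K_def F_M_adj_def power2_eq_square algebra_simps)
qed

text \<open>In null coordinates \<open>k\<close> vanishes along z~ and w~, and \<open>L\<close> has
  the slopes l \<alpha>, l \<beta>, \<beta>, \<alpha> along z, w, z~, w~. Along z and w,
  \<open>L\<close> is thus proportional to \<open>k\<close>. The quadratic term matters only in the
  first relation for \<open>F_K\<close>, where it cancels the derivative terms.\<close>

lemma field_strength_coefficients_ASD:
  assumes "F = F_M \<or> F = F_K \<or> F = F_M_adj"
  shows "F 1 2 + F 1 4 + F 3 2 + F 3 4 = 0"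
    and "F 1 4 - F 1 2 + F 3 2 - F 3 4 = 0"
    and "(F 1 1 - F 1 3 + F 3 1 - F 3 3) - (F 2 4 - F 2 2 - F 4 2 + F 4 4) = 0"
  using assms
  by (elim disjE; simp add: F_M_def F_K_def F_M_adj_def L_axis k_def c_def algebra_simps)+

lemma A_anti_self_dual: "anti_self_dual_YM A"
  unfolding anti_self_dual_YM_def null_field_strength_eq field_strength_eq scaleR_eq_mscale
proof (intro allI conjI, goal_cases)
  note F_M = field_strength_coefficients_ASD[OF disjI1, OF refl]
  note F_K = field_strength_coefficients_ASD[OF disjI2, OF disjI1, OF refl]
  note F_M_adj = field_strength_coefficients_ASD[OF disjI2, OF disjI2, OF refl]
  case (1 x) show ?case
    by (rule mat2_eqI; simp; use F_M(1) F_K(1) F_M_adj(1) in algebra)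
  case (2 x) show ?case
    by (rule mat2_eqI; simp; use F_M(2) F_K(2) F_M_adj(2) in algebra)
  case (3 x) show ?case
    by (rule mat2_eqI; simp; use F_M(3) F_K(3) F_M_adj(3) in algebra)
qed

section \<open>Traces, contractions and the Lagrangian density\<close>

text \<open>\<open>M'\<close> is nilpotent, which removes f^2 and h^2. In the basis of the columns
  of \<psi>, \<open>K\<close> is diagonal and \<open>M'\<close> off-diagonal, which removes the
  mixed terms with g.\<close>

lemma trace_combination:
  "trace ((mscale f (M' x) + mscale g (K x) + mscale h (ctranspose (M' x))) **
          (mscale f (M' x) + mscale g (K x) + mscale h (ctranspose (M' x)))) =
     8 * e0 * cnj e0 * (I x) ^ 4 * (f * h * E x * cnj (E x) + g\<^sup>2 * e0 * cnj e0)"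
  by (simp add: trace_def sum_2, simp add: M'_def M_def K_def P_def mat_def)
     (use D_I[of x] in algebra)

definition \<eta> :: "4 \<Rightarrow> 4 \<Rightarrow> complex" where
  "\<eta> \<mu> \<nu> = of_real (split_metric $ \<mu> $ \<mu> * split_metric $ \<nu> $ \<nu>)"

lemma F_M_contraction:
  "(\<Sum>\<mu>\<in>UNIV. \<Sum>\<nu>\<in>UNIV. \<eta> \<mu> \<nu> * (F_M \<mu> \<nu> * F_M_adj \<mu> \<nu>)) =
     8 * ((\<alpha> * cnj \<beta> - cnj \<alpha> * \<beta>) * (l - cnj l))\<^sup>2"
  by (simp add: sum_4 \<eta>_def split_metric_def F_M_def F_M_adj_def L_axis, simp add: k_def c_def)
     (use inv_sqrt2_square in algebra)

lemma F_K_contraction: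
  "(\<Sum>\<mu>\<in>UNIV. \<Sum>\<nu>\<in>UNIV. \<eta> \<mu> \<nu> * (F_K \<mu> \<nu>)\<^sup>2) =
     - 16 * ((\<alpha> * cnj \<beta> - cnj \<alpha> * \<beta>) * (l - cnj l))\<^sup>2"
  by (simp add: sum_4 \<eta>_def split_metric_def F_K_def L_axis, simp add: k_def c_def)
     (use inv_sqrt2_square in algebra)

lemma lagrangian_density_eq:
  "lagrangian_density A x =
     64 * ((\<alpha> * cnj \<beta> - cnj \<alpha> * \<beta>) * (l - cnj l))\<^sup>2 * (e0 * cnj e0)
        * (E x * cnj (E x) - 2 * (e0 * cnj e0)) / D x ^ 4"
proof -
  have "trace (field_strength A \<mu> \<nu> x ** raised_field_strength A \<mu> \<nu> x) =
      8 * e0 * cnj e0 * (I x) ^ 4 * E x * cnj (E x) * (\<eta> \<mu> \<nu> * (F_M \<mu> \<nu> * F_M_adj \<mu> \<nu>)) +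
      8 * (e0 * cnj e0)\<^sup>2 * (I x) ^ 4 * (\<eta> \<mu> \<nu> * (F_K \<mu> \<nu>)\<^sup>2)" for \<mu> \<nu>
  proof -
    have "trace (field_strength A \<mu> \<nu> x ** raised_field_strength A \<mu> \<nu> x) =
        \<eta> \<mu> \<nu> * trace (field_strength A \<mu> \<nu> x ** field_strength A \<mu> \<nu> x)"
      unfolding raised_field_strength_eq scaleR_eq_mscale \<eta>_def
      by (simp add: trace_def sum_2 algebra_simps)
    then show ?thesis
      unfolding field_strength_eq trace_combination by (simp add: algebra_simps power2_eq_square)
  qed
  then have "lagrangian_density A x =
      8 * e0 * cnj e0 * (I x) ^ 4 * E x * cnj (E x) * (8 * ((\<alpha> * cnj \<beta> - cnj \<alpha> * \<beta>) * (l - cnj l))\<^sup>2) +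
      8 * (e0 * cnj e0)\<^sup>2 * (I x) ^ 4 * (- 16 * ((\<alpha> * cnj \<beta> - cnj \<alpha> * \<beta>) * (l - cnj l))\<^sup>2)"
    unfolding lagrangian_density_def F_M_contraction[symmetric] F_K_contraction[symmetric]
    by (simp only: sum.distrib sum_distrib_left)
  \<comment> \<open>The contractions 8 and -16 have ratio -2, the coefficient of
    \<open>e0 * cnj e0\<close> in the bracket.\<close>
  also have "\<dots> = 64 * ((\<alpha> * cnj \<beta> - cnj \<alpha> * \<beta>) * (l - cnj l))\<^sup>2 * (e0 * cnj e0)
        * (E x * cnj (E x) - 2 * (e0 * cnj e0)) * (I x) ^ 4"
    by algebra
  finally show ?thesis
    by (simp add: I_def power_inverse divide_inverse)
qed

section \<open>The gauge algebra and reality of the density\<close>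

lemma A_antihermitian: "ctranspose (A \<mu> x) = - A \<mu> x"
proof -
  \<comment> \<open>The imaginary constant \<open>c\<close> multiplies a Hermitian matrix, namely
    \<open>k \<mu>\<close> times \<open>M\<close> plus its adjoint.\<close>
  have "cnj c = - c" by (simp add: c_def algebra_simps)
  then show ?thesis
    unfolding A_eq by (intro mat2_eqI) (simp_all add: algebra_simps)
qed

lemma A_traceless: "trace (A \<mu> x) = 0"
  unfolding A_eq by (simp add: trace_def sum_2 M_def)

text \<open>\<open>\<alpha> * cnj \<beta> - cnj \<alpha> * \<beta>\<close> and
  \<open>l - cnj l\<close> are both imaginary, so their product is real.\<close>

lemma lagrangian_density_real: "lagrangian_density A x \<in> \<real>"
proof -
  have "cnj (D x) = D x" by (simp add: D_def mult.commute)
  moreover have "(cnj ((\<alpha> * cnj \<beta> - cnj \<alpha> * \<beta>) * (l - cnj l)))\<^sup>2 = ((\<alpha> * cnj \<beta> - cnj \<alpha> * \<beta>) * (l - cnj l))\<^sup>2"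
    unfolding complex_cnj_mult complex_cnj_diff complex_cnj_cnj by algebra
  ultimately show ?thesis
    unfolding Reals_cnj_iff lagrangian_density_eq by (simp add: mult.commute)
qed

section \<open>Hyperbolic form of the density\<close>

definition \<epsilon>1 :: real where "\<epsilon>1 = (cmod a1)\<^sup>2 + (cmod b1)\<^sup>2"
definition \<epsilon>1' :: real where "\<epsilon>1' = (cmod a2)\<^sup>2 + (cmod b2)\<^sup>2"
definition \<epsilon>2 :: complex where "\<epsilon>2 = a1 * cnj a2 + b1 * cnj b2"

definition X1 where "X1 x = L x + cnj (L x) + of_real (1/2 * ln (\<epsilon>1 / \<epsilon>1'))"
definition X2 where "X2 x = L x - cnj (L x) + 1/2 * log_phase \<epsilon>2"
definition S :: complex where "S = of_real (sqrt (\<epsilon>1 * \<epsilon>1'))"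
definition R :: complex where "R = of_real (cmod \<epsilon>2)"

lemma \<epsilon>1_pos: "\<epsilon>1 > 0" and \<epsilon>1'_pos: "\<epsilon>1' > 0"
  using wronskian_nonzero by (auto simp: \<epsilon>1_def \<epsilon>1'_def sum_power2_gt_zero_iff)

lemma S_nonzero: "S \<noteq> 0"
  using \<epsilon>1_pos \<epsilon>1'_pos by (simp add: S_def)

lemma S_square: "S\<^sup>2 = of_real (\<epsilon>1 * \<epsilon>1')"
  using \<epsilon>1_pos \<epsilon>1'_pos unfolding S_def of_real_power[symmetric] by simp

lemma R_square: "R\<^sup>2 = \<epsilon>2 * cnj \<epsilon>2"
  unfolding R_def complex_norm_square[symmetric] by simp

lemma lagrange_identity: "\<epsilon>1 * \<epsilon>1' = (cmod \<epsilon>2)\<^sup>2 + (cmod e0)\<^sup>2"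
proof -
  have "complex_of_real (\<epsilon>1 * \<epsilon>1') = of_real ((cmod \<epsilon>2)\<^sup>2 + (cmod e0)\<^sup>2)"
    unfolding of_real_add of_real_mult complex_norm_square e0_def \<epsilon>1_def \<epsilon>1'_def \<epsilon>2_def
    by (simp add: algebra_simps)
  then show ?thesis by (simp only: of_real_eq_iff)
qed

text \<open>The shift in \<open>X1\<close> exponentiates to sqrt (\<epsilon>1 / \<epsilon>1'), which
  together with \<open>S\<close> separates the two coefficients.\<close>

lemma exp_X1:
  "S * exp (X1 x) = of_real \<epsilon>1 * (exp (L x) * exp (cnj (L x)))"
  "S * exp (- X1 x) = of_real \<epsilon>1' * (exp (- L x) * exp (- cnj (L x)))"
proof -
  define t where "t = exp (1/2 * ln (\<epsilon>1 / \<epsilon>1'))"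
  have t: "t = sqrt \<epsilon>1 / sqrt \<epsilon>1'"
    using \<epsilon>1_pos \<epsilon>1'_pos by (simp add: t_def ln_div exp_diff diff_divide_distrib flip: ln_sqrt)
  have "sqrt (\<epsilon>1 * \<epsilon>1') * t = \<epsilon>1" "sqrt (\<epsilon>1 * \<epsilon>1') * inverse t = \<epsilon>1'"
    using \<epsilon>1_pos \<epsilon>1'_pos by (auto simp: t real_sqrt_mult)
  then have S: "S * of_real t = of_real \<epsilon>1" "S * inverse (of_real t) = of_real \<epsilon>1'"
    unfolding S_def by (metis of_real_mult, metis of_real_mult of_real_inverse)
  have "exp (complex_of_real (1/2 * ln (\<epsilon>1 / \<epsilon>1'))) = of_real t"
    unfolding t_def by (rule exp_of_real)
  then show "S * exp (X1 x) = of_real \<epsilon>1 * (exp (L x) * exp (cnj (L x)))"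
    "S * exp (- X1 x) = of_real \<epsilon>1' * (exp (- L x) * exp (- cnj (L x)))"
    unfolding X1_def exp_minus exp_add S[symmetric]
    by (simp_all only: inverse_mult_distrib mult.commute mult.left_commute)
qed

text \<open>
  Stated with the factor \<^term>\<open>R\<close>, these also hold when \<open>\<epsilon>2 = 0\<close>, where \<^term>\<open>X2\<close> is a junk value.
\<close>

lemma exp_X2:
  "R * exp (X2 x) = \<epsilon>2 * (exp (L x) * exp (- cnj (L x)))"
  "R * exp (- X2 x) = cnj \<epsilon>2 * (exp (- L x) * exp (cnj (L x)))"
proof -
  define t where "t = exp (1/2 * log_phase \<epsilon>2)"
  have "R * t = \<epsilon>2 \<and> R * inverse t = cnj \<epsilon>2"
  proof (cases "\<epsilon>2 = 0")
    case False
    then have "R * t = \<epsilon>2"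
      using exp_half_log_phase[OF False] by (simp add: t_def R_def)
    moreover have "t \<noteq> 0" by (simp add: t_def)
    moreover have "R \<noteq> 0" using False by (simp add: R_def)
    moreover from this have "R = t * cnj \<epsilon>2"
      using R_square \<open>R * t = \<epsilon>2\<close> by (metis mult.assoc mult_left_cancel power2_eq_square)
    ultimately show ?thesis by (simp add: field_simps)
  qed (simp add: R_def)
  then have t: "R * t = \<epsilon>2" "R * inverse t = cnj \<epsilon>2" by simp_all
  have X2: "exp (X2 x) = exp (L x) * exp (- cnj (L x)) * t"
    "exp (- X2 x) = exp (- L x) * exp (cnj (L x)) * inverse t"
    unfolding X2_def t_def[symmetric] exp_add exp_diff exp_minus by (simp_all add: divide_inverse)
  show "R * exp (X2 x) = \<epsilon>2 * (exp (L x) * exp (- cnj (L x)))"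
    by (simp only: X2 ac_simps flip: t(1))
  show "R * exp (- X2 x) = cnj \<epsilon>2 * (exp (- L x) * exp (cnj (L x)))"
    by (simp only: X2 ac_simps flip: t(2))
qed

text \<open>Expanding \<open>D\<close> gives four exponentials, with coefficients
  \<open>\<epsilon>1\<close>, \<open>\<epsilon>1'\<close>, \<open>\<epsilon>2\<close> and
  \<open>cnj \<epsilon>2\<close>; the shifts in \<open>X1\<close> and \<open>X2\<close> make each
  pair symmetric.\<close>

lemma D_cosh: "D x = 2 * (S * cosh (X1 x) + R * cosh (X2 x))"
proof -
  have "2 * (S * cosh (X1 x) + R * cosh (X2 x)) =
      S * exp (X1 x) + S * exp (- X1 x) + R * exp (X2 x) + R * exp (- X2 x)"
    by (simp add: cosh_field_def add_divide_distrib algebra_simps)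
  also have "\<dots> = D x"
    unfolding exp_X1 exp_X2 D_def p_def r_def \<epsilon>1_def \<epsilon>1'_def \<epsilon>2_def of_real_add complex_norm_square
    by (simp add: exp_minus exp_cnj algebra_simps)
  finally show ?thesis ..
qed

text \<open>These are the derivatives of \<open>D_cosh\<close> in \<open>L\<close> and in
  \<open>cnj (L x)\<close>. Only \<open>X2\<close> changes sign with the latter, so the product of
  the two is a difference of squares.\<close>

lemma E_sinh:
  "E x = 2 * (S * sinh (X1 x) + R * sinh (X2 x))"
  "cnj (E x) = 2 * (S * sinh (X1 x) - R * sinh (X2 x))"
proof -
  have "2 * (S * sinh (X1 x) + R * sinh (X2 x)) =
      S * exp (X1 x) - S * exp (- X1 x) + R * exp (X2 x) - R * exp (- X2 x)"
    by (simp add: sinh_field_def add_divide_distrib diff_divide_distrib algebra_simps)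
  also have "\<dots> = E x"
    unfolding exp_X1 exp_X2 E_def p_def r_def p'_def r'_def \<epsilon>1_def \<epsilon>1'_def \<epsilon>2_def of_real_add
      complex_norm_square
    by (simp add: exp_minus exp_cnj algebra_simps)
  finally show "E x = 2 * (S * sinh (X1 x) + R * sinh (X2 x))" ..
  have "2 * (S * sinh (X1 x) - R * sinh (X2 x)) =
      S * exp (X1 x) - S * exp (- X1 x) - R * exp (X2 x) + R * exp (- X2 x)"
    by (simp add: sinh_field_def add_divide_distrib diff_divide_distrib algebra_simps)
  also have "\<dots> = cnj (E x)"
    unfolding exp_X1 exp_X2 E_def p_def r_def p'_def r'_def \<epsilon>1_def \<epsilon>1'_def \<epsilon>2_def of_real_add
      complex_norm_square
    by (simp add: exp_minus exp_cnj algebra_simps)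
  finally show "cnj (E x) = 2 * (S * sinh (X1 x) - R * sinh (X2 x))" ..
qed

lemma cosh_sum_nonzero: "S * cosh (X1 x) + R * cosh (X2 x) \<noteq> 0"
  by (metis D_cosh D_nonzero mult_zero_right)

text \<open>The factor 4 of \<open>E x * cnj (E x)\<close> and the 2^4 in the fourth power of
  \<open>D x\<close> turn the constant 64 into 8.\<close>

lemma lagrangian_density_cosh:
  "lagrangian_density A x =
     8 * ((\<alpha> * cnj \<beta> - cnj \<alpha> * \<beta>) * (l - cnj l) * of_real (cmod e0))\<^sup>2 *
       ((2 * of_real (\<epsilon>1 * \<epsilon>1') * (sinh (X1 x))\<^sup>2
         - 2 * of_real ((cmod \<epsilon>2)\<^sup>2) * (sinh (X2 x))\<^sup>2 - of_real ((cmod e0)\<^sup>2))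
        / (S * cosh (X1 x) + R * cosh (X2 x)) ^ 4)"
proof -
  have R: "of_real ((cmod \<epsilon>2)\<^sup>2) = R\<^sup>2" by (simp add: R_def)
  have e: "e0 * cnj e0 = of_real ((cmod e0)\<^sup>2)" by (rule complex_norm_square[symmetric])
  have E: "E x * cnj (E x) = 4 * (S\<^sup>2 * (sinh (X1 x))\<^sup>2 - R\<^sup>2 * (sinh (X2 x))\<^sup>2)"
    unfolding E_sinh(2) by (subst E_sinh(1)) algebra
  define G where "G = S * cosh (X1 x) + R * cosh (X2 x)"
  have "G \<noteq> 0" unfolding G_def by (rule cosh_sum_nonzero)
  then show ?thesis
    unfolding lagrangian_density_eq E D_cosh S_square[symmetric] R e G_def[symmetric] power_mult_distrib
    by (simp add: field_simps)
qed

lemma lagrangian_density_sech: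
  assumes "\<epsilon>2 = 0"
  shows "cosh (X1 x) \<noteq> 0"
    and "lagrangian_density A x =
      8 * ((\<alpha> * cnj \<beta> - cnj \<alpha> * \<beta>) * (l - cnj l))\<^sup>2 *
        (2 * (1 / cosh (X1 x))\<^sup>2 - 3 * (1 / cosh (X1 x)) ^ 4)"
proof -
  have R: "R = 0" using assms by (simp add: R_def)
  show nz: "cosh (X1 x) \<noteq> 0"
    using cosh_sum_nonzero[of x] by (auto simp: R)
  \<comment> \<open>For \<open>\<epsilon>2 = 0\<close> the Lagrange identity makes |e0|^2 equal to
    S^2, so every power of \<open>S\<close> cancels and the bracket becomes 2 cosh^2 - 3.\<close>
  have e: "of_real (\<epsilon>1 * \<epsilon>1') = S\<^sup>2" "of_real ((cmod e0)\<^sup>2) = S\<^sup>2"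
    using lagrange_identity assms by (simp_all add: S_square)
  have sinh: "(sinh (X1 x))\<^sup>2 = (cosh (X1 x))\<^sup>2 - 1"
    using cosh_square_eq[of "X1 x"] by simp
  have "lagrangian_density A x = 8 * ((\<alpha> * cnj \<beta> - cnj \<alpha> * \<beta>) * (l - cnj l))\<^sup>2 * S\<^sup>2 *
      ((2 * S\<^sup>2 * ((cosh (X1 x))\<^sup>2 - 1) - S\<^sup>2) / (S * cosh (X1 x)) ^ 4)"
    unfolding lagrangian_density_cosh power_mult_distrib[of _ "of_real (cmod e0)"] e
      of_real_power[symmetric] sinh
    by (simp add: R assms)
  also have "\<dots> = 8 * ((\<alpha> * cnj \<beta> - cnj \<alpha> * \<beta>) * (l - cnj l))\<^sup>2 *
        (2 * (1 / cosh (X1 x))\<^sup>2 - 3 * (1 / cosh (X1 x)) ^ 4)"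
  proof -
    have "S\<^sup>2 * ((2 * S\<^sup>2 * ((cosh (X1 x))\<^sup>2 - 1) - S\<^sup>2) / (S * cosh (X1 x)) ^ 4) =
        2 * (1 / cosh (X1 x))\<^sup>2 - 3 * (1 / cosh (X1 x)) ^ 4"
      using nz S_nonzero by (simp add: field_simps power2_eq_square power4_eq_xxxx)
    then show ?thesis by (simp only: mult.assoc)
  qed
  finally show "lagrangian_density A x =
      8 * ((\<alpha> * cnj \<beta> - cnj \<alpha> * \<beta>) * (l - cnj l))\<^sup>2 *
        (2 * (1 / cosh (X1 x))\<^sup>2 - 3 * (1 / cosh (X1 x)) ^ 4)" .
qed

end

text \<open>Invertibility, differentiability and nonzero denominators are asserted because
  \<open>matrix_inv\<close>, \<open>frechet_derivative\<close> and division have default values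
  where they are not meaningful; together they express that the density is well defined
  everywhere.\<close>

theorem mainTheorem1:
  fixes a1 a2 b1 b2 \<alpha> \<beta> l \<epsilon>0 \<epsilon>2 :: complex
    and \<epsilon>1 \<epsilon>1' :: real
    and L X1 X2 :: "real^4 \<Rightarrow> complex"
    and \<psi> J :: "real^4 \<Rightarrow> complex^2^2"
    and A :: "4 \<Rightarrow> real^4 \<Rightarrow> complex^2^2"
  assumes "l \<noteq> 0"
    and "\<epsilon>0 = a1 * b2 - a2 * b1"
    and "\<epsilon>0 \<noteq> 0"
    and "\<epsilon>1 = (cmod a1)\<^sup>2 + (cmod b1)\<^sup>2"
    and "\<epsilon>1' = (cmod a2)\<^sup>2 + (cmod b2)\<^sup>2"
    and "\<epsilon>2 = a1 * cnj a2 + b1 * cnj b2"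
    and "L = soliton_L \<alpha> \<beta> l"
    and "\<psi> = soliton_psi a1 a2 b1 b2 L"
    and "J = soliton_J l \<psi>"
    and "A = soliton_A J"
    and "X1 = (\<lambda>x. L x + cnj (L x) + of_real (1/2 * ln (\<epsilon>1 / \<epsilon>1')))"
    and "X2 = (\<lambda>x. L x - cnj (L x) + 1/2 * log_phase \<epsilon>2)"
  shows
    "\<epsilon>1 * \<epsilon>1' = (cmod \<epsilon>2)\<^sup>2 + (cmod \<epsilon>0)\<^sup>2 \<and>
     (\<forall>x. invertible (\<psi> x)) \<and>
     (\<forall>x. J differentiable (at x)) \<and>
     (\<forall>\<mu> x. A \<mu> differentiable (at x)) \<and>
     (\<forall>x. J x ** ctranspose (J x) = mat (of_real ((cmod l)\<^sup>2))) \<and>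
     anti_self_dual_YM A \<and>
     (\<forall>\<mu> x. ctranspose (A \<mu> x) = - A \<mu> x \<and> trace (A \<mu> x) = 0) \<and>
     (\<forall>x. lagrangian_density A x \<in> \<real>) \<and>
     (\<epsilon>2 \<noteq> 0 \<longrightarrow> (\<forall>x.
        of_real (sqrt (\<epsilon>1 * \<epsilon>1')) * cosh (X1 x) + of_real (cmod \<epsilon>2) * cosh (X2 x) \<noteq> 0 \<and>
        lagrangian_density A x =
          8 * ((\<alpha> * cnj \<beta> - cnj \<alpha> * \<beta>) * (l - cnj l) * of_real (cmod \<epsilon>0))\<^sup>2 *
          ((2 * of_real (\<epsilon>1 * \<epsilon>1') * (sinh (X1 x))\<^sup>2
            - 2 * of_real ((cmod \<epsilon>2)\<^sup>2) * (sinh (X2 x))\<^sup>2 - of_real ((cmod \<epsilon>0)\<^sup>2))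
           / (of_real (sqrt (\<epsilon>1 * \<epsilon>1')) * cosh (X1 x) + of_real (cmod \<epsilon>2) * cosh (X2 x)) ^ 4))) \<and>
     (\<epsilon>2 = 0 \<longrightarrow> (\<forall>x.
        cosh (X1 x) \<noteq> 0 \<and>
        lagrangian_density A x =
          8 * ((\<alpha> * cnj \<beta> - cnj \<alpha> * \<beta>) * (l - cnj l) * of_real (cmod \<epsilon>0))\<^sup>2 *
          ((2 * of_real (\<epsilon>1 * \<epsilon>1') * (sinh (X1 x))\<^sup>2 - of_real ((cmod \<epsilon>0)\<^sup>2))
           / (of_real (sqrt (\<epsilon>1 * \<epsilon>1')) * cosh (X1 x)) ^ 4) \<and>
        lagrangian_density A x =
          8 * ((\<alpha> * cnj \<beta> - cnj \<alpha> * \<beta>) * (l - cnj l))\<^sup>2 *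
          (2 * (1 / cosh (X1 x))\<^sup>2 - 3 * (1 / cosh (X1 x)) ^ 4)))"
proof -
  interpret s: soliton a1 a2 b1 b2 \<alpha> \<beta> l
    using assms(1-3) by unfold_locales simp_all
  have eqs: "\<epsilon>0 = s.e0" "\<epsilon>1 = s.\<epsilon>1" "\<epsilon>1' = s.\<epsilon>1'" "\<epsilon>2 = s.\<epsilon>2" "L = s.L" "\<psi> = s.\<psi>" "J = s.J" "A = s.A"
    by (simp_all only: assms(2-10) s.e0_def s.\<epsilon>1_def s.\<epsilon>1'_def s.\<epsilon>2_def)
  have X: "X1 = s.X1" "X2 = s.X2"
    unfolding fun_eq_iff s.X1_def s.X2_def eqs[symmetric] assms(11,12) by simp_all
  have "invertible (s.\<psi> x)" for x
    using s.psi_inverse invertible_right_inverse by blast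
  moreover note differentiableI[OF s.J_derivative] differentiableI[OF s.A_derivative]
  moreover note s.cosh_sum_nonzero[unfolded s.S_def s.R_def]
  moreover note s.lagrangian_density_cosh[unfolded s.S_def s.R_def]
  \<comment> \<open>Here \<open>R\<close> is 0, so the \<open>X2\<close> terms vanish whatever the
    value of \<open>log_phase 0\<close>.\<close>
  moreover have "s.\<epsilon>2 = 0 \<Longrightarrow> lagrangian_density s.A x =
          8 * ((\<alpha> * cnj \<beta> - cnj \<alpha> * \<beta>) * (l - cnj l) * of_real (cmod s.e0))\<^sup>2 *
          ((2 * of_real (s.\<epsilon>1 * s.\<epsilon>1') * (sinh (s.X1 x))\<^sup>2 - of_real ((cmod s.e0)\<^sup>2))
           / (of_real (sqrt (s.\<epsilon>1 * s.\<epsilon>1')) * cosh (s.X1 x)) ^ 4)" for x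
    unfolding s.lagrangian_density_cosh by (simp add: s.S_def s.R_def)
  moreover note s.lagrange_identity s.J_unitary s.A_anti_self_dual s.A_antihermitian s.A_traceless
    s.lagrangian_density_real s.lagrangian_density_sech
  ultimately show ?thesis
    unfolding eqs X by (intro conjI allI impI) metis+
qed

end
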